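(* Let $k\ge 1$ be an integer and let $\mathbb{K}$ be a finite field with $|\mathbb{K}|=q$ such that $\operatorname{char}(\mathbb{K})\nmid k$ and $\operatorname{char}(\mathbb{K})\nmid k+1$. Let $n,m,l\ge 1$ and consider the poset $Y=\{r_1,\ldots,r_n,s_1,\ldots,s_m,t_1,\ldots,t_l\}$ whose order is generated by the relations: - $r_1\le r_2\le\cdots\le r_n$, $s_1\le s_2\le\cdots\le s_m$ and $t_1\le t_2\le\cdots\le t_l$; - $r_n\le s_i$ for $i=1,\ldots,m$ and $r_n\le t_j$ for $j=1,\ldots,l$. Suppose the equation $x^{k+1}=x$ has exactly $s$ solutions in $\mathbb{K}$. Then the number of $(k+1)$-potent elements in the incidence algebra $\mathcal{I}(Y,\mathbb{K})$ is $$\sum_{\substack{n_1+\cdots+n_s=n\\ m_1+\cdots+m_s=m\\ l_1+\cdots+l_s=l\\ n_i,m_i,l_i\ge 0}}\binom{n}{n_1,\ldots,n_s}\binom{m}{m_1,\ldots,m_s}\binom{l}{l_1,\ldots,l_s}\cdot\mathcal{F}(n_1,\ldots,n_s,m_1,\ldots,m_s,l_1,\ldots,l_s),$$ where $$\mathcal{F}(n_1,\ldots,n_s,m_1,\ldots,m_s,l_1,\ldots,l_s)=q^{\sum_{1\le i<j\le s}(n_in_j+m_im_j+l_il_j)}\cdot q^{\sum_{1\le i\ne j\le s}n_i(m_j+l_j)},$$ the last sum being over all ordered pairs $(i,j)$ with $i,j\in\{1,\ldots,s\}$, $i\ne j$.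
   Context: For a finite poset $X$ and a field $\mathbb{K}$, the incidence algebra is $\mathcal{I}(X,\mathbb{K})=\{f:X\times X\to\mathbb{K}\ :\ f(x,y)=0 \text{ if } x\not\le y\}$ with pointwise addition and scalar multiplication and product $(f\cdot g)(x,y)=\sum_{x\le t\le y}f(x,t)g(t,y)$. An element $g$ is $(k+1)$-potent if $g^{k+1}=g$. In the poset $Y$, each $s_i$ is incomparable with each $t_j$. The integer $s$ (number of solutions) is unrelated to the poset elements $s_1,\ldots,s_m$. $\binom{n}{n_1,\ldots,n_s}=\frac{n!}{n_1!\cdots n_s!}$ is the multinomial coefficient. *)

theory Defs
  imports "HOL-Algebra.Module" "HOL-Computational_Algebra.Primes" "HOL-Library.FuncSet" "HOL-Library.Cardinality"
begin

(* A finite poset is a carrier X with an order relation r, as in partial_order_on X r.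
   Functions on X x X are represented by functions on the whole type that are 0 outside
   X x X, so that every element of the incidence algebra has exactly one representative. *)

definition incidence_algebra ::
    "'p set \<Rightarrow> ('p \<times> 'p) set \<Rightarrow> ('a::field, 'p \<times> 'p \<Rightarrow> 'a) module" where
  "incidence_algebra X r =
    \<lparr>carrier = {f. \<forall>x y. \<not> (x \<in> X \<and> y \<in> X \<and> (x, y) \<in> r) \<longrightarrow> f (x, y) = 0},
     monoid.mult = (\<lambda>f g (x, y). \<Sum>t | t \<in> X \<and> (x, t) \<in> r \<and> (t, y) \<in> r. f (x, t) * g (t, y)),
     one = (\<lambda>(x, y). if x \<in> X \<and> x = y then 1 else 0),
     zero = (\<lambda>_. 0),
     add = (\<lambda>f g z. f z + g z),
     smult = (\<lambda>c f z. c * f z)\<rparr>"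

definition potents :: "('b, 'c) monoid_scheme \<Rightarrow> nat \<Rightarrow> 'b set" where
  "potents A p = {g \<in> carrier A. g [^]\<^bsub>A\<^esub> p = g}"

datatype Y_elem = Yr nat | Ys nat | Yt nat

definition Y_carrier :: "nat \<Rightarrow> nat \<Rightarrow> nat \<Rightarrow> Y_elem set" where
  "Y_carrier n m l = Yr ` {1..n} \<union> Ys ` {1..m} \<union> Yt ` {1..l}"

definition Y_gen :: "nat \<Rightarrow> nat \<Rightarrow> nat \<Rightarrow> (Y_elem \<times> Y_elem) set" where
  "Y_gen n m l =
     {(Yr i, Yr (i + 1)) | i. 1 \<le> i \<and> i < n} \<union>
     {(Ys i, Ys (i + 1)) | i. 1 \<le> i \<and> i < m} \<union>
     {(Yt i, Yt (i + 1)) | i. 1 \<le> i \<and> i < l} \<union>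
     {(Yr n, Ys i) | i. 1 \<le> i \<and> i \<le> m} \<union>
     {(Yr n, Yt j) | j. 1 \<le> j \<and> j \<le> l}"

(* The closure is reflexive on the whole type Y_elem, hence the restriction to the carrier. *)
definition Y_le :: "nat \<Rightarrow> nat \<Rightarrow> nat \<Rightarrow> (Y_elem \<times> Y_elem) set" where
  "Y_le n m l = (Y_gen n m l)\<^sup>* \<inter> (Y_carrier n m l \<times> Y_carrier n m l)"

definition compositions :: "nat \<Rightarrow> nat \<Rightarrow> (nat \<Rightarrow> nat) set" where
  "compositions s n = {c \<in> {1..s} \<rightarrow>\<^sub>E UNIV. (\<Sum>i=1..s. c i) = n}"

(* Used only for c with c 1 + ... + c s = n, where the division is exact. *)
definition multinomial :: "nat \<Rightarrow> nat \<Rightarrow> (nat \<Rightarrow> nat) \<Rightarrow> nat" where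
  "multinomial s n c = fact n div (\<Prod>i=1..s. fact (c i))"

definition F_count :: "nat \<Rightarrow> nat \<Rightarrow> (nat \<Rightarrow> nat) \<Rightarrow> (nat \<Rightarrow> nat) \<Rightarrow> (nat \<Rightarrow> nat) \<Rightarrow> nat" where
  "F_count q s a b c =
     q ^ (\<Sum>(i, j) | 1 \<le> i \<and> i < j \<and> j \<le> s. a i * a j + b i * b j + c i * c j) *
     q ^ (\<Sum>(i, j) | i \<in> {1..s} \<and> j \<in> {1..s} \<and> i \<noteq> j. a i * (b j + c j))"

end

theory Submission
  imports Defs "HOL-Combinatorics.Multiset_Permutations"
begin

text \<open>Let \<open>X\<close> be any finite poset and fix the diagonal \<open>d\<close> of a \<open>(k+1)\<close>-potent element \<open>g\<close>; its
  entries are roots of \<open>x ^ (k + 1) = x\<close>. As \<open>k\<close> is invertible in the field, \<open>g\<close> is conjugate to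
  the diagonal matrix \<open>D\<close> of \<open>d\<close> by a unitriangular element. So the potents with diagonal \<open>d\<close> form
  one orbit of the unitriangular group, the stabilizer of \<open>D\<close> consists of the unitriangular \<open>u\<close>
  with \<open>u (x, y) = 0\<close> whenever \<open>d x \<noteq> d y\<close>, and the orbit has size \<open>q ^ e\<close> where \<open>e\<close> counts the
  pairs \<open>x < y\<close> with \<open>d x \<noteq> d y\<close>. For the poset \<open>Y\<close> the number \<open>e\<close> depends only on how often each
  root occurs on each of the three chains, and multinomial coefficients count the \<open>d\<close> with given
  frequencies.\<close>

section \<open>Potent elements of the incidence algebra of a finite poset\<close>

text \<open>Only the values on \<open>S\<close> are free. The whole algebra, the unitriangular
  elements and the stabilizers all have this form, so each size is a power of the field
  size.\<close>

lemma card_functions_prescribed_off: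
  fixes h :: "'z \<Rightarrow> 'a::finite"
  assumes "finite S"
  shows "card {f. \<forall>z. z \<notin> S \<longrightarrow> f z = h z} = CARD('a) ^ card S"
proof -
  have "bij_betw (\<lambda>f z. if z \<in> S then f z else h z) (S \<rightarrow>\<^sub>E UNIV) {f. \<forall>z. z \<notin> S \<longrightarrow> f z = h z}"
    by (rule bij_betw_byWitness[where f' = "\<lambda>f. restrict f S"])
       (auto simp: fun_eq_iff PiE_def extensional_def)
  then show ?thesis
    using assms by (simp add: bij_betw_same_card[symmetric] card_funcsetE)
qed

text \<open>The algebra \<open>A\<close> is a parameter pinned down by an equation, so that it can
  be declared a structure and the monoid notation refers to it.\<close>

locale finite_incidence_algebra =
  fixes X :: "'p set" and r :: "('p \<times> 'p) set"
    and A :: "('a::{field,finite}, 'p \<times> 'p \<Rightarrow> 'a) module" (structure)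
  assumes finite_X: "finite X"
    and order: "partial_order_on X r"
    and A_eq: "A = incidence_algebra X r"
begin

lemma r_refl: "x \<in> X \<Longrightarrow> (x, x) \<in> r"
  and r_trans: "(x, y) \<in> r \<Longrightarrow> (y, z) \<in> r \<Longrightarrow> (x, z) \<in> r"
  and r_antisym: "(x, y) \<in> r \<Longrightarrow> (y, x) \<in> r \<Longrightarrow> x = y"
  and r_closed: "(x, y) \<in> r \<Longrightarrow> x \<in> X" "(x, y) \<in> r \<Longrightarrow> y \<in> X"
  using partial_order_onD[OF order] by (auto simp: refl_on_def dest: transD antisymD)

lemma finite_r: "finite r"
  using partial_order_onD(4)[OF order] finite_X by (auto intro: finite_subset)

section \<open>The incidence algebra as a monoid of matrices\<close>

lemma carrier_eq: "carrier A = {f. \<forall>z. z \<notin> r \<longrightarrow> f z = 0}"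
proof -
  have "(x \<in> X \<and> y \<in> X \<and> (x, y) \<in> r) = ((x, y) \<in> r)" for x y
    using r_closed by blast
  then show ?thesis by (simp add: A_eq incidence_algebra_def)
qed

lemma carrierI: "(\<And>x y. (x, y) \<notin> r \<Longrightarrow> f (x, y) = 0) \<Longrightarrow> f \<in> carrier A"
  by (auto simp: carrier_eq)

lemma carrierD: "f \<in> carrier A \<Longrightarrow> (x, y) \<notin> r \<Longrightarrow> f (x, y) = 0"
  by (auto simp: carrier_eq)

lemma finite_carrier: "finite (carrier A)"
proof (rule card_ge_0_finite)
  show "card (carrier A) > 0"
    unfolding carrier_eq card_functions_prescribed_off[OF finite_r] by simp
qed

text \<open>Terms outside the interval vanish because one of the two factors does. With a fixed
  index set the product is the usual matrix product.\<close>

lemma mult_apply: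
  assumes "f \<in> carrier A" "g \<in> carrier A"
  shows "(f \<otimes> g) (x, y) = (\<Sum>t\<in>X. f (x, t) * g (t, y))"
proof -
  have "(f \<otimes> g) (x, y) = (\<Sum>t | t \<in> X \<and> (x, t) \<in> r \<and> (t, y) \<in> r. f (x, t) * g (t, y))"
    by (simp add: A_eq incidence_algebra_def)
  also have "\<dots> = (\<Sum>t\<in>X. f (x, t) * g (t, y))"
    using assms finite_X by (intro sum.mono_neutral_left) (auto, (metis carrierD)+)
  finally show ?thesis .
qed

text \<open>A nonzero term needs \<open>t\<close> with x \<le> t \<le> x, hence
  \<open>t = x\<close>. So taking the diagonal is multiplicative.\<close>

lemma mult_diag:
  assumes "f \<in> carrier A" "g \<in> carrier A" "x \<in> X"
  shows "(f \<otimes> g) (x, x) = f (x, x) * g (x, x)"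
proof -
  have "(\<Sum>t\<in>X. f (x, t) * g (t, x)) = (\<Sum>t\<in>{x}. f (x, t) * g (t, x))"
    using assms finite_X by (intro sum.mono_neutral_right) (auto, metis carrierD r_antisym)
  then show ?thesis
    using assms by (simp add: mult_apply)
qed

definition diag_matrix :: "('p \<Rightarrow> 'a) \<Rightarrow> 'p \<times> 'p \<Rightarrow> 'a" where
  "diag_matrix d = (\<lambda>(x, y). if x \<in> X \<and> x = y then d x else 0)"

lemma one_eq: "\<one> = diag_matrix (\<lambda>_. 1)"
  by (auto simp: A_eq incidence_algebra_def diag_matrix_def fun_eq_iff)

lemma diag_matrix_closed [simp]: "diag_matrix d \<in> carrier A"
  by (rule carrierI) (auto simp: diag_matrix_def r_refl)

lemma mult_closed: "f \<in> carrier A \<Longrightarrow> g \<in> carrier A \<Longrightarrow> f \<otimes> g \<in> carrier A"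
proof (rule carrierI)
  fix x y assume "f \<in> carrier A" "g \<in> carrier A" "(x, y) \<notin> r"
  moreover from this have "f (x, t) * g (t, y) = 0" for t
    using r_trans[of x t y] carrierD[of f x t] carrierD[of g t y] by fastforce
  ultimately show "(f \<otimes> g) (x, y) = 0"
    by (simp only: mult_apply sum.neutral_const)
qed

lemma mult_diag_matrix: "f \<in> carrier A \<Longrightarrow> (f \<otimes> diag_matrix d) (x, y) = f (x, y) * d y"
proof -
  assume f: "f \<in> carrier A"
  have "(\<Sum>t\<in>X. f (x, t) * diag_matrix d (t, y)) = (\<Sum>t\<in>X. if t = y then f (x, y) * d y else 0)"
    by (rule sum.cong) (auto simp: diag_matrix_def)
  then show ?thesis
    using f finite_X by (auto simp: mult_apply, (metis carrierD r_closed)+)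
qed

lemma diag_matrix_mult: "f \<in> carrier A \<Longrightarrow> (diag_matrix d \<otimes> f) (x, y) = d x * f (x, y)"
proof -
  assume f: "f \<in> carrier A"
  have "(\<Sum>t\<in>X. diag_matrix d (x, t) * f (t, y)) = (\<Sum>t\<in>X. if t = x then d x * f (x, y) else 0)"
    by (rule sum.cong) (auto simp: diag_matrix_def)
  then show ?thesis
    using f finite_X by (auto simp: mult_apply, (metis carrierD r_closed)+)
qed

lemma mult_assoc:
  assumes "f \<in> carrier A" "g \<in> carrier A" "h \<in> carrier A"
  shows "(f \<otimes> g) \<otimes> h = f \<otimes> (g \<otimes> h)"
proof
  fix z :: "'p \<times> 'p"
  obtain x y where z: "z = (x, y)" by (cases z)
  have "((f \<otimes> g) \<otimes> h) z = (\<Sum>s\<in>X. \<Sum>t\<in>X. f (x, t) * g (t, s) * h (s, y))"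
    using assms by (simp add: z mult_apply mult_closed sum_distrib_right)
  also have "\<dots> = (\<Sum>t\<in>X. \<Sum>s\<in>X. f (x, t) * g (t, s) * h (s, y))"
    by (rule sum.swap)
  also have "\<dots> = (f \<otimes> (g \<otimes> h)) z"
    using assms by (simp add: z mult_apply mult_closed sum_distrib_left mult.assoc)
  finally show "((f \<otimes> g) \<otimes> h) z = (f \<otimes> (g \<otimes> h)) z" .
qed

sublocale monoid A
proof (rule monoidI)
  show "\<one> \<in> carrier A" unfolding one_eq by (rule diag_matrix_closed)
  fix f assume f: "f \<in> carrier A"
  show "\<one> \<otimes> f = f"
    unfolding one_eq by (rule ext, clarify) (simp add: diag_matrix_mult f)
  show "f \<otimes> \<one> = f"
    unfolding one_eq by (rule ext, clarify) (simp add: mult_diag_matrix f)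
qed (fact mult_closed mult_assoc)+

lemma one_apply: "\<one> (x, y) = (if x \<in> X \<and> x = y then 1 else 0)"
  by (simp add: one_eq diag_matrix_def)

lemma pow_diag:
  "f \<in> carrier A \<Longrightarrow> x \<in> X \<Longrightarrow> (f [^] (i::nat)) (x, x) = f (x, x) ^ i"
  by (induction i) (simp_all add: mult_diag one_apply)

lemma diag_matrix_pow: "diag_matrix d [^] (i::nat) = diag_matrix (\<lambda>x. d x ^ i)"
proof (induction i)
  case (Suc i)
  have "(diag_matrix d [^] Suc i) (x, y) = diag_matrix (\<lambda>x. d x ^ Suc i) (x, y)" for x y
    using Suc by (simp add: mult_diag_matrix del: power_Suc) (auto simp: diag_matrix_def)
  then show ?case by (simp add: fun_eq_iff)
qed (simp add: one_eq)

section \<open>The unitriangular group and diagonalization\<close>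

definition unitriangular :: "('p \<times> 'p \<Rightarrow> 'a) set" where
  "unitriangular = {u \<in> carrier A. \<forall>x\<in>X. u (x, x) = 1}"

lemma unitriangularD: "u \<in> unitriangular \<Longrightarrow> u \<in> carrier A" "u \<in> unitriangular \<Longrightarrow> x \<in> X \<Longrightarrow> u (x, x) = 1"
  by (auto simp: unitriangular_def)

lemma unitriangular_mult: "u \<in> unitriangular \<Longrightarrow> v \<in> unitriangular \<Longrightarrow> u \<otimes> v \<in> unitriangular"
  by (auto simp: unitriangular_def mult_diag)

text \<open>The entry of \<open>f \<otimes> u\<close> at \<open>(x, y)\<close> is
  \<open>f (x, y)\<close> plus terms with \<open>f (x, t)\<close> for \<open>t < y\<close>. So row
  \<open>x\<close> of \<open>f\<close> can be recovered by induction on \<open>y\<close>.\<close>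

lemma unitriangular_right_cancel:
  assumes u: "u \<in> unitriangular" and f: "f \<in> carrier A" and h: "h \<in> carrier A"
    and eq: "f \<otimes> u = h \<otimes> u"
  shows "f = h"
proof
  fix z :: "'p \<times> 'p"
  obtain x y where z: "z = (x, y)" by (cases z)
  have "wf (r - Id)"
    by (rule partial_order_on_well_order_on[OF finite_r order])
  then have "f (x, y) = h (x, y)"
  proof (induction y rule: wf_induct_rule)
    case (less y)
    show ?case
    proof (cases "y \<in> X")
      case True
      have "(\<Sum>t\<in>X. f (x, t) * u (t, y)) = (\<Sum>t\<in>X. h (x, t) * u (t, y))"
        using fun_cong[OF eq, of "(x, y)"] u f h by (simp add: mult_apply unitriangularD)
      \<comment> \<open>For \<open>t\<close> other than \<open>y\<close>, either
        \<open>t < y\<close> and the induction hypothesis applies, or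
        \<open>u (t, y) = 0\<close>.\<close>
      moreover have "(\<Sum>t\<in>X - {y}. f (x, t) * u (t, y)) = (\<Sum>t\<in>X - {y}. h (x, t) * u (t, y))"
        by (rule sum.cong) (auto, metis DiffI carrierD less.IH mult_cancel_right pair_in_Id_conv u unitriangularD(1))
      ultimately show ?thesis
        using True u finite_X by (simp add: sum.remove unitriangularD)
    qed (use f h in \<open>metis carrierD r_closed(2)\<close>)
  qed
  then show "f z = h z" by (simp add: z)
qed

text \<open>Right multiplication by \<open>u\<close> is injective on a finite set, hence onto; this replaces the
  Neumann series for the inverse of \<open>u\<close>.\<close>
lemma unitriangular_inverse:
  assumes u: "u \<in> unitriangular"
  obtains v where "v \<in> unitriangular" "v \<otimes> u = \<one>" "u \<otimes> v = \<one>"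
proof -
  have uc: "u \<in> carrier A" using u by (rule unitriangularD)
  have "inj_on (\<lambda>f. f \<otimes> u) (carrier A)"
    using unitriangular_right_cancel[OF u] by (auto intro: inj_onI)
  then have "(\<lambda>f. f \<otimes> u) ` carrier A = carrier A"
    using uc by (intro endo_inj_surj finite_carrier) auto
  then obtain v where v: "v \<in> carrier A" "v \<otimes> u = \<one>"
    by (metis (mono_tags, lifting) imageE one_closed)
  \<comment> \<open>Surjectivity yields a left inverse only; cancelling \<open>u\<close> on the
    right makes it two-sided.\<close>
  have "(u \<otimes> v) \<otimes> u = \<one> \<otimes> u"
    using uc v by (simp add: m_assoc)
  then have uv: "u \<otimes> v = \<one>"
    using unitriangular_right_cancel[OF u] uc v(1) by blast
  have "v (x, x) = 1" if "x \<in> X" for x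
    using mult_diag[OF v(1) uc that] that u by (simp add: v(2) one_apply unitriangularD)
  then have "v \<in> unitriangular"
    using v(1) by (simp add: unitriangular_def)
  with v(2) uv show ?thesis by (rule that[rotated])
qed

text \<open>For fixed diagonal \<open>d\<close>, an intertwiner \<open>u\<close> between \<open>g\<close> and its diagonal exists columnwise: column \<open>y\<close>
  of \<open>u\<close> is that column of the spectral projection of \<open>g\<close> to the eigenvalue \<open>d y\<close>,
  which is \<open>1 - g ^ k\<close> for eigenvalue \<open>0\<close> and the average of \<open>(g / d y) ^ i\<close> over \<open>1 \<le> i \<le> k\<close> otherwise.\<close>
lemma intertwiner_exists:
  assumes k: "k \<ge> 1" "(of_nat k :: 'a) \<noteq> 0"
    and g: "g \<in> carrier A" "g [^] (k + 1) = g"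
    and d: "\<And>x. x \<in> X \<Longrightarrow> g (x, x) = d x"
  obtains u where "u \<in> unitriangular" "g \<otimes> u = u \<otimes> diag_matrix d"
proof -
  \<comment> \<open>The power \<open>d y ^ (k - Suc i)\<close> stands for the inverse of
    \<open>d y ^ Suc i\<close>, because a nonzero root satisfies \<open>d y ^ k = 1\<close>.\<close>
  define u where "u = (\<lambda>(x, y). if d y = 0 then \<one> (x, y) - (g [^] k) (x, y)
    else inverse (of_nat k) * (\<Sum>i<k. (g [^] Suc i) (x, y) * d y ^ (k - Suc i)))"
  have root: "d x ^ (k + 1) = d x" if "x \<in> X" for x
    using pow_diag[OF g(1) that, of "k + 1"] g(2) d[OF that] by simp
  have uc: "u \<in> carrier A"
  proof (rule carrierI)
    fix x y assume "(x, y) \<notin> r"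
    then have "(g [^] i) (x, y) = 0" for i :: nat
      by (rule carrierD[OF nat_pow_closed[OF g(1)]])
    from this this[of "Suc _"] show "u (x, y) = 0"
      using \<open>(x, y) \<notin> r\<close> by (simp add: u_def carrierD[OF one_closed] del: nat_pow_Suc)
  qed
  have "u (x, x) = 1" if x: "x \<in> X" for x
  proof (cases "d x = 0")
    case True
    then show ?thesis using k x g by (simp add: u_def one_apply pow_diag d)
  next
    case False
    then have 1: "d x ^ k = 1" using root[OF x] by simp
    \<comment> \<open>On the diagonal each of the \<open>k\<close> summands is
      \<open>d x ^ k = 1\<close>, so their average is 1.\<close>
    have "(\<Sum>i<k. (g [^] Suc i) (x, x) * d x ^ (k - Suc i)) = (\<Sum>i<k. 1)"
    proof (intro sum.cong refl)
      fix i assume "i \<in> {..<k}"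
      then show "(g [^] Suc i) (x, x) * d x ^ (k - Suc i) = 1"
        unfolding pow_diag[OF g(1) x] d[OF x] power_add[symmetric] by (simp add: 1)
    qed
    then show ?thesis using False k by (simp add: u_def del: nat_pow_Suc)
  qed
  then have uU: "u \<in> unitriangular" using uc by (simp add: unitriangular_def)
  have "(g \<otimes> u) (x, y) = u (x, y) * d y" for x y
  proof (cases "y \<in> X")
    case False
    then have "(x, y) \<notin> r" using r_closed by blast
    then show ?thesis using carrierD[OF uc] carrierD[OF m_closed[OF g(1) uc]] by simp
  next
    case y: True
    show ?thesis
    proof (cases "d y = 0")
      case True
      \<comment> \<open>This column of \<open>g \<otimes> u\<close> is that of
        \<open>g - g [^] (k + 1)\<close>, which is zero.\<close>
      have "(g \<otimes> u) (x, y) = (\<Sum>t\<in>X. g (x, t) * \<one> (t, y)) - (\<Sum>t\<in>X. g (x, t) * (g [^] k) (t, y))"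
        unfolding mult_apply[OF g(1) uc] by (simp add: True u_def right_diff_distrib sum_subtractf)
      also have "\<dots> = (g \<otimes> \<one>) (x, y) - (g \<otimes> g [^] k) (x, y)"
        unfolding mult_apply[OF g(1) one_closed] mult_apply[OF g(1) nat_pow_closed[OF g(1)]] ..
      also have "g \<otimes> g [^] k = g"
        using nat_pow_Suc2[OF g(1), of k] g(2) by (simp del: nat_pow_Suc)
      finally show ?thesis using True g(1) by simp
    next
      case False
      \<comment> \<open>Multiplying the sum by \<open>g\<close> gives the \<open>F (Suc i)\<close>,
        multiplying it by \<open>d y\<close> gives the \<open>F i\<close>. The two sums agree
        because \<open>F k = F 0\<close>: here \<open>g [^] (k + 1) = g\<close> and
        \<open>d y ^ k = 1\<close> enter.\<close>
      define F where "F i = (g [^] Suc i) (x, y) * d y ^ (k - i)" for i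
      have "(g \<otimes> u) (x, y) = inverse (of_nat k) * (\<Sum>t\<in>X. \<Sum>i<k. g (x, t) * (g [^] Suc i) (t, y) * d y ^ (k - Suc i))"
        unfolding mult_apply[OF g(1) uc] by (simp add: False u_def sum_distrib_left mult_ac del: nat_pow_Suc)
      also have "\<dots> = inverse (of_nat k) * (\<Sum>i<k. (g \<otimes> g [^] Suc i) (x, y) * d y ^ (k - Suc i))"
        by (subst sum.swap) (simp only: mult_apply[OF g(1) nat_pow_closed[OF g(1)]] sum_distrib_right)
      also have "\<dots> = inverse (of_nat k) * (\<Sum>i<k. F (Suc i))"
        by (simp only: F_def nat_pow_Suc2[OF g(1), of "Suc _"])
      also have "(\<Sum>i<k. F (Suc i)) = (\<Sum>i<k. F i)"
      proof -
        have "(\<Sum>i<k. F (Suc i)) - (\<Sum>i<k. F i) = F k - F 0"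
          by (simp add: sum_subtractf[symmetric] sum_lessThan_telescope)
        also have "F k = g (x, y)" using g(2) by (simp add: F_def)
        also have "F 0 = g (x, y)" using root[OF y] False g(1) by (simp add: F_def)
        finally show ?thesis by simp
      qed
      also have "(\<Sum>i<k. F i) = (\<Sum>i<k. (g [^] Suc i) (x, y) * d y ^ (k - Suc i)) * d y"
        unfolding sum_distrib_right F_def
        by (intro sum.cong refl) (simp add: Suc_diff_Suc mult.assoc power_Suc2[symmetric] del: nat_pow_Suc power_Suc)
      finally show ?thesis using False by (simp add: u_def mult.assoc del: nat_pow_Suc)
    qed
  qed
  then have "g \<otimes> u = u \<otimes> diag_matrix d"
    using uc by (auto simp: fun_eq_iff mult_diag_matrix)
  with uU show ?thesis by (rule that)
qed

text \<open>Exactly the entries at pairs \<open>x < y\<close> are free; this is the form needed for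
  counting.\<close>

lemma unitriangular_eq: "unitriangular = {f. \<forall>z. z \<notin> r - Id \<longrightarrow> f z = \<one> z}"
proof (intro equalityI subsetI CollectI allI impI)
  fix u z assume u: "u \<in> unitriangular" and z: "z \<notin> r - Id"
  obtain x y where xy: "z = (x, y)" by (cases z)
  show "u z = \<one> z"
  proof (cases "x = y \<and> x \<in> X")
    case True
    then show ?thesis using u by (auto simp: xy one_apply unitriangularD)
  next
    case False
    then have "z \<notin> r" using z r_closed by (auto simp: xy)
    then show ?thesis using False u by (auto simp: xy one_apply carrierD unitriangularD)
  qed
next
  fix u assume "u \<in> {f. \<forall>z. z \<notin> r - Id \<longrightarrow> f z = \<one> z}"
  then show "u \<in> unitriangular"
    using r_refl by (auto simp: unitriangular_def carrier_eq one_apply)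
qed

section \<open>Sizes of the group, the stabilizers and the orbits\<close>

lemma card_unitriangular: "card unitriangular = CARD('a) ^ card (r - Id)"
  unfolding unitriangular_eq by (rule card_functions_prescribed_off) (simp add: finite_r)

text \<open>This is the stabilizer of the diagonal matrix under conjugation, stated without
  inverses.\<close>

definition unitriangular_centralizer :: "('p \<Rightarrow> 'a) \<Rightarrow> ('p \<times> 'p \<Rightarrow> 'a) set" where
  "unitriangular_centralizer d = {u \<in> unitriangular. u \<otimes> diag_matrix d = diag_matrix d \<otimes> u}"

text \<open>Comparing entries, commuting means \<open>u (x, y) * d y = d x * u (x, y)\<close>. This
  forces \<open>u (x, y) = 0\<close> where \<open>d x\<close> and \<open>d y\<close> differ and says
  nothing elsewhere.\<close>

lemma card_unitriangular_centralizer: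
  "card (unitriangular_centralizer d) = CARD('a) ^ card {(x, y) \<in> r - Id. d x = d y}"
proof -
  have "unitriangular_centralizer d = {f. \<forall>z. z \<notin> {(x, y) \<in> r - Id. d x = d y} \<longrightarrow> f z = \<one> z}"
    (is "_ = ?B")
  proof (intro equalityI subsetI)
    fix u assume "u \<in> unitriangular_centralizer d"
    then have u: "u \<in> unitriangular" and "u \<otimes> diag_matrix d = diag_matrix d \<otimes> u"
      by (simp_all add: unitriangular_centralizer_def)
    then have "u (x, y) * d y = d x * u (x, y)" for x y
      by (metis mult_diag_matrix diag_matrix_mult unitriangularD(1))
    then have 0: "u (x, y) = 0" if "d x \<noteq> d y" for x y
      using that by (simp add: mult.commute) metis
    show "u \<in> ?B"
    proof (intro CollectI allI impI)
      fix z assume z: "z \<notin> {(x, y) \<in> r - Id. d x = d y}"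
      obtain x y where xy: "z = (x, y)" by (cases z)
      show "u z = \<one> z"
      proof (cases "d x = d y")
        case True
        then show ?thesis using z u by (simp add: xy unitriangular_eq)
      next
        case False
        then show ?thesis using 0 by (auto simp: xy one_apply)
      qed
    qed
  next
    fix u assume u: "u \<in> ?B"
    then have "u \<in> unitriangular"
      by (auto simp: unitriangular_eq)
    moreover have "u (x, y) * d y = d x * u (x, y)" for x y
      using u by (cases "(x, y) \<in> r - Id \<and> d x = d y") (auto simp: one_apply)
    ultimately show "u \<in> unitriangular_centralizer d"
      by (auto simp: unitriangular_centralizer_def fun_eq_iff mult_diag_matrix diag_matrix_mult unitriangularD)
  qed
  then show ?thesis
    by (simp only:) (rule card_functions_prescribed_off, rule finite_subset[OF _ finite_r], auto)
qed

definition potents_with_diag :: "nat \<Rightarrow> ('p \<Rightarrow> 'a) \<Rightarrow> ('p \<times> 'p \<Rightarrow> 'a) set" where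
  "potents_with_diag k d = {g \<in> potents A (k + 1). \<forall>x\<in>X. g (x, x) = d x}"

text \<open>The only candidate is the conjugate of the diagonal matrix by \<open>u\<close>. It
  inherits potency from that matrix, and its diagonal is \<open>d\<close> since diagonals
  multiply.\<close>

lemma intertwining_unique:
  assumes d: "\<And>x. x \<in> X \<Longrightarrow> d x ^ (k + 1) = d x" and u: "u \<in> unitriangular"
  shows "\<exists>!g. g \<in> potents_with_diag k d \<and> g \<otimes> u = u \<otimes> diag_matrix d"
proof -
  obtain v where v: "v \<in> unitriangular" "v \<otimes> u = \<one>" "u \<otimes> v = \<one>"
    using unitriangular_inverse[OF u] .
  note uc = unitriangularD(1)[OF u] and vc = unitriangularD(1)[OF v(1)]
  define D where "D = diag_matrix d"
  have Dc: "D \<in> carrier A" by (simp add: D_def)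
  define g where "g = u \<otimes> D \<otimes> v"
  have gc: "g \<in> carrier A" using uc vc Dc by (simp add: g_def)
  have gu: "g \<otimes> u = u \<otimes> D"
    using uc vc Dc by (simp add: g_def m_assoc v(2))
  \<comment> \<open>The relation passes to powers, so potency of \<open>D\<close> gives potency of
    \<open>g\<close> after cancelling \<open>u\<close>.\<close>
  have pow: "g [^] i \<otimes> u = u \<otimes> D [^] i" for i :: nat
  proof (induction i)
    case (Suc i)
    have "g [^] Suc i \<otimes> u = g [^] i \<otimes> (g \<otimes> u)" using gc uc by (simp add: m_assoc)
    also have "\<dots> = (g [^] i \<otimes> u) \<otimes> D" using gc uc Dc by (simp add: gu m_assoc)
    also have "\<dots> = u \<otimes> D [^] Suc i" using uc Dc by (simp add: Suc m_assoc)
    finally show ?case .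
  qed (use uc in simp)
  have "D [^] (k + 1) = D"
    unfolding D_def diag_matrix_pow using d by (auto simp: diag_matrix_def fun_eq_iff)
  then have "g [^] (k + 1) \<otimes> u = g \<otimes> u"
    using pow[of "k + 1"] gu by simp
  then have "g [^] (k + 1) = g"
    using unitriangular_right_cancel[OF u _ gc] gc nat_pow_closed by blast
  moreover have "g (x, x) = d x" if "x \<in> X" for x
    using that uc vc Dc u v(1) by (simp add: g_def mult_diag unitriangularD) (simp add: D_def diag_matrix_def)
  ultimately have "g \<in> potents_with_diag k d"
    using gc by (simp add: potents_with_diag_def potents_def)
  moreover have "g' = g" if "g' \<in> potents_with_diag k d" "g' \<otimes> u = u \<otimes> D" for g'
    using unitriangular_right_cancel[OF u, of g' g] that gc gu
    by (simp add: potents_with_diag_def potents_def)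
  ultimately show ?thesis using gu unfolding D_def by blast
qed

text \<open>If \<open>u\<close> is one intertwiner, all of them form the coset of the stabilizer
  obtained by multiplying by \<open>u\<close> on the left.\<close>

lemma card_intertwiners:
  assumes k: "k \<ge> 1" "(of_nat k :: 'a) \<noteq> 0" and g: "g \<in> potents_with_diag k d"
  shows "card {u \<in> unitriangular. g \<otimes> u = u \<otimes> diag_matrix d} = card (unitriangular_centralizer d)"
proof -
  define D where "D = diag_matrix d"
  have Dc: "D \<in> carrier A" by (simp add: D_def)
  have gc: "g \<in> carrier A" and gpow: "g [^] (k + 1) = g" and gd: "\<And>x. x \<in> X \<Longrightarrow> g (x, x) = d x"
    using g by (simp_all add: potents_with_diag_def potents_def)
  obtain u where u: "u \<in> unitriangular" "g \<otimes> u = u \<otimes> D"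
    using intertwiner_exists[OF k gc gpow gd] unfolding D_def by blast
  obtain v where v: "v \<in> unitriangular" "v \<otimes> u = \<one>" "u \<otimes> v = \<one>"
    using unitriangular_inverse[OF u(1)] .
  note uc = unitriangularD(1)[OF u(1)] and vc = unitriangularD(1)[OF v(1)]
  \<comment> \<open>Multiplying by the inverse on both sides turns the relation for \<open>u\<close>
    into one for \<open>v\<close>, which sends intertwiners back to the stabilizer.\<close>
  have "v \<otimes> (g \<otimes> u) \<otimes> v = v \<otimes> (u \<otimes> D) \<otimes> v" by (simp add: u(2))
  then have vg: "v \<otimes> g = D \<otimes> v"
    using uc vc gc Dc v by (simp add: m_assoc) (simp add: m_assoc[symmetric] v)
  have "bij_betw ((\<otimes>) u) (unitriangular_centralizer d) {w \<in> unitriangular. g \<otimes> w = w \<otimes> D}"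
  proof (rule bij_betw_byWitness[where f' = "(\<otimes>) v"])
    show "\<forall>c\<in>unitriangular_centralizer d. v \<otimes> (u \<otimes> c) = c"
      using uc vc v by (auto simp: unitriangular_centralizer_def unitriangularD m_assoc[symmetric])
    show "\<forall>w\<in>{w \<in> unitriangular. g \<otimes> w = w \<otimes> D}. u \<otimes> (v \<otimes> w) = w"
      using uc vc v by (auto simp: unitriangularD m_assoc[symmetric])
    show "(\<otimes>) u ` unitriangular_centralizer d \<subseteq> {w \<in> unitriangular. g \<otimes> w = w \<otimes> D}"
    proof clarify
      fix c assume "c \<in> unitriangular_centralizer d"
      then have c: "c \<in> unitriangular" "c \<otimes> D = D \<otimes> c"
        by (simp_all add: unitriangular_centralizer_def D_def)
      note cc = unitriangularD(1)[OF c(1)]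
      have "g \<otimes> (u \<otimes> c) = u \<otimes> c \<otimes> D"
        using gc uc cc Dc by (simp add: m_assoc[symmetric] u(2)) (simp add: m_assoc c(2))
      then show "u \<otimes> c \<in> unitriangular \<and> g \<otimes> (u \<otimes> c) = u \<otimes> c \<otimes> D"
        using u(1) c(1) by (simp add: unitriangular_mult)
    qed
    show "(\<otimes>) v ` {w \<in> unitriangular. g \<otimes> w = w \<otimes> D} \<subseteq> unitriangular_centralizer d"
    proof clarify
      fix w assume w: "w \<in> unitriangular" "g \<otimes> w = w \<otimes> D"
      note wc = unitriangularD(1)[OF w(1)]
      have "v \<otimes> w \<otimes> D = D \<otimes> (v \<otimes> w)"
        using gc vc wc Dc by (simp add: m_assoc w(2)[symmetric]) (simp add: m_assoc[symmetric] vg)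
      then show "v \<otimes> w \<in> unitriangular_centralizer d"
        using v(1) w(1) by (simp add: unitriangular_centralizer_def unitriangular_mult D_def)
    qed
  qed
  then show ?thesis
    unfolding D_def by (rule bij_betw_same_card[symmetric])
qed

text \<open>Double counting of the pairs \<open>(g, u)\<close> with \<open>g u = u D\<close>.\<close>
lemma card_potents_with_diag:
  assumes k: "k \<ge> 1" "(of_nat k :: 'a) \<noteq> 0" and d: "\<And>x. x \<in> X \<Longrightarrow> d x ^ (k + 1) = d x"
  shows "card (potents_with_diag k d) = CARD('a) ^ card {(x, y) \<in> r. d x \<noteq> d y}"
proof -
  define S where "S = {(x, y) \<in> r - Id. d x = d y}"
  define T where "T = {(x, y) \<in> r. d x \<noteq> d y}"
  have finU: "finite unitriangular" and finG: "finite (potents_with_diag k d)"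
    using finite_carrier
    by (auto simp: unitriangular_def potents_with_diag_def potents_def)
  have "CARD('a) ^ card (r - Id) = (\<Sum>u\<in>unitriangular. 1)"
    by (simp add: card_unitriangular)
  also have "\<dots> = (\<Sum>u\<in>unitriangular. card {g \<in> potents_with_diag k d. g \<otimes> u = u \<otimes> diag_matrix d})"
  proof (intro sum.cong refl)
    fix u assume "u \<in> unitriangular"
    then obtain g where "{g \<in> potents_with_diag k d. g \<otimes> u = u \<otimes> diag_matrix d} = {g}"
      using intertwining_unique[of d k u] d by blast
    then show "1 = card {g \<in> potents_with_diag k d. g \<otimes> u = u \<otimes> diag_matrix d}" by simp
  qed
  also have "\<dots> = (\<Sum>g\<in>potents_with_diag k d. card {u \<in> unitriangular. g \<otimes> u = u \<otimes> diag_matrix d})"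
    by (rule sum_multicount_gen[OF finU finG]) simp
  also have "\<dots> = card (potents_with_diag k d) * CARD('a) ^ card S"
    using card_intertwiners[OF k] by (simp add: card_unitriangular_centralizer S_def)
  finally have "CARD('a) ^ card (r - Id) = card (potents_with_diag k d) * CARD('a) ^ card S" .
  \<comment> \<open>Distinct labels already force \<open>x\<close> and \<open>y\<close> to be
    distinct, so \<open>T\<close> and \<open>S\<close> split the strict pairs and the factor for
    \<open>S\<close> cancels.\<close>
  moreover have "card (r - Id) = card T + card S"
    unfolding S_def T_def using finite_r
    by (subst card_Un_disjoint[symmetric]) (auto intro: finite_subset[OF _ finite_r] arg_cong[where f = card])
  ultimately show ?thesis by (simp add: power_add T_def)
qed

text \<open>The potents are sorted by their diagonal, whose entries are roots because diagonals
  multiply. Restricting it to \<open>X\<close> gives one representative per diagonal.\<close>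

theorem card_potents:
  assumes k: "k \<ge> 1" "(of_nat k :: 'a) \<noteq> 0"
  shows "card (potents A (k + 1)) =
    (\<Sum>d \<in> X \<rightarrow>\<^sub>E {x::'a. x ^ (k + 1) = x}. CARD('a) ^ card {(x, y) \<in> r. d x \<noteq> d y})"
proof -
  let ?diag = "\<lambda>g. \<lambda>x\<in>X. g (x, x)"
  have fin: "finite (potents A (k + 1))"
    using finite_carrier by (auto simp: potents_def)
  have "?diag g \<in> X \<rightarrow>\<^sub>E {x::'a. x ^ (k + 1) = x}" if g: "g \<in> potents A (k + 1)" for g
  proof (intro restrict_PiE_iff[THEN iffD2] ballI CollectI)
    fix x assume "x \<in> X"
    with pow_diag[of g x "k + 1"] g show "g (x, x) ^ (k + 1) = g (x, x)"
      by (simp add: potents_def)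
  qed
  then have "card (potents A (k + 1))
      = (\<Sum>d \<in> X \<rightarrow>\<^sub>E {x::'a. x ^ (k + 1) = x}. card {g \<in> potents A (k + 1). ?diag g = d})"
    using sum.group[OF fin _ image_subsetI, of "X \<rightarrow>\<^sub>E {x::'a. x ^ (k + 1) = x}" ?diag "\<lambda>_. 1::nat"]
    by (simp add: finite_PiE finite_X del: restrict_PiE_iff PiE_iff power_Suc)
  also have "\<dots> = (\<Sum>d \<in> X \<rightarrow>\<^sub>E {x::'a. x ^ (k + 1) = x}. CARD('a) ^ card {(x, y) \<in> r. d x \<noteq> d y})"
  proof (intro sum.cong refl)
    fix d assume d: "d \<in> X \<rightarrow>\<^sub>E {x::'a. x ^ (k + 1) = x}"
    then have "{g \<in> potents A (k + 1). ?diag g = d} = potents_with_diag k d"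
      by (auto simp: potents_with_diag_def fun_eq_iff PiE_def extensional_def)
    then show "card {g \<in> potents A (k + 1). ?diag g = d} = CARD('a) ^ card {(x, y) \<in> r. d x \<noteq> d y}"
      using card_potents_with_diag[OF k, of d] d by auto
  qed
  finally show ?thesis .
qed

end

section \<open>Labelings of chains\<close>

lemma finite_compositions: "finite (compositions s n)"
proof (rule finite_subset)
  show "compositions s n \<subseteq> {1..s} \<rightarrow>\<^sub>E {..n}"
  proof
    fix c assume c: "c \<in> compositions s n"
    then have "c i \<le> n" if "i \<in> {1..s}" for i
      using member_le_sum[OF that, of c] by (simp add: compositions_def)
    then show "c \<in> {1..s} \<rightarrow>\<^sub>E {..n}"
      using c by (auto simp: compositions_def PiE_def)
  qed
qed (simp add: finite_PiE)

text \<open>The multiplicities of the labels 1 to \<open>s\<close>, made extensional so as to be an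
  element of \<open>compositions\<close>.\<close>

definition fibre_sizes :: "nat \<Rightarrow> nat \<Rightarrow> (nat \<Rightarrow> nat) \<Rightarrow> nat \<Rightarrow> nat" where
  "fibre_sizes s n f = (\<lambda>p\<in>{1..s}. card {i \<in> {1..n}. f i = p})"

lemma fibre_sizes_in_compositions:
  assumes "f \<in> {1..n} \<rightarrow>\<^sub>E {1..s}"
  shows "fibre_sizes s n f \<in> compositions s n"
proof -
  have "(\<Sum>p\<in>{1..s}. card {i \<in> {1..n}. f i = p}) = n"
    using assms sum.group[of "{1..n}" "{1..s}" f "\<lambda>_. 1::nat"] by (auto simp: PiE_def)
  then show ?thesis by (simp add: compositions_def fibre_sizes_def)
qed

text \<open>Read as the word of its values, such a labeling is an arrangement of the multiset
  containing each label \<open>p\<close> exactly \<open>a p\<close> times.\<close>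

lemma card_fibre_sizes:
  assumes a: "a \<in> compositions s n"
  shows "card {f \<in> {1..n} \<rightarrow>\<^sub>E {1..s}. fibre_sizes s n f = a} = multinomial s n a"
proof -
  define M where "M = (\<Sum>p\<in>{1..s}. replicate_mset (a p) p)"
  have count_M: "count M p = (if p \<in> {1..s} then a p else 0)" for p
    by (simp add: M_def count_sum)
  have size_M: "size M = n"
    using a by (simp add: M_def compositions_def)
  \<comment> \<open>Labels that do not occur contribute the factor
    \<open>fact 0 = 1\<close>.\<close>
  have "(\<Prod>p\<in>set_mset M. fact (count M p)) = (\<Prod>p\<in>{1..s}. fact (a p) :: nat)"
    by (rule prod.mono_neutral_cong_left) (auto simp: count_M simp flip: count_greater_zero_iff split: if_splits)
  then have "card (permutations_of_multiset M) = multinomial s n a"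
    by (simp add: card_permutations_of_multiset size_M multinomial_def)
  moreover
  have "bij_betw (\<lambda>f. map f [1..<Suc n])
      {f \<in> {1..n} \<rightarrow>\<^sub>E {1..s}. fibre_sizes s n f = a} (permutations_of_multiset M)"
  \<comment> \<open>Chains are numbered from 1 and lists from 0, hence the index
    \<open>i - 1\<close>.\<close>
  proof (rule bij_betw_byWitness[where f' = "\<lambda>xs. \<lambda>i\<in>{1..n}. xs ! (i - 1)"])
    have count_map: "count (mset (map f [1..<Suc n])) p = card {i \<in> {1..n}. f i = p}"
      for f :: "nat \<Rightarrow> nat" and p
    proof -
      have "count (mset (map f is)) p = length (filter (\<lambda>i. f i = p) is)" for "is"
        by (induction "is") auto
      also have "length (filter (\<lambda>i. f i = p) [1..<Suc n]) = card {i \<in> {1..n}. f i = p}"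
        by (subst distinct_card[symmetric]) (auto intro!: arg_cong[where f = card])
      finally show ?thesis .
    qed
    show "(\<lambda>f. map f [1..<Suc n]) ` {f \<in> {1..n} \<rightarrow>\<^sub>E {1..s}. fibre_sizes s n f = a}
        \<subseteq> permutations_of_multiset M"
    proof (clarify, intro permutations_of_multisetI multiset_eqI)
      fix f p assume f: "f \<in> {1..n} \<rightarrow>\<^sub>E {1..s}" and a: "a = fibre_sizes s n f"
      have "{i \<in> {1..n}. f i = p} = {}" if "p \<notin> {1..s}"
        using f that by fastforce
      then show "count (mset (map f [1..<Suc n])) p = count M p"
        unfolding count_map count_M by (simp add: a fibre_sizes_def)
    qed
    have map_nth: "map (\<lambda>i\<in>{1..n}. xs ! (i - 1)) [1..<Suc n] = xs" if "xs \<in> permutations_of_multiset M" for xs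
      using length_finite_permutations_of_multiset[OF that]
      by (auto simp: list_eq_iff_nth_eq size_M simp del: upt_Suc)
    then show "\<forall>xs\<in>permutations_of_multiset M. map (\<lambda>i\<in>{1..n}. xs ! (i - 1)) [1..<Suc n] = xs"
      by blast
    show "(\<lambda>xs. \<lambda>i\<in>{1..n}. xs ! (i - 1)) ` permutations_of_multiset M \<subseteq>
        {f \<in> {1..n} \<rightarrow>\<^sub>E {1..s}. fibre_sizes s n f = a}"
    proof (intro image_subsetI CollectI conjI)
      fix xs assume xs: "xs \<in> permutations_of_multiset M"
      let ?f = "\<lambda>i\<in>{1..n}. xs ! (i - 1)"
      have M: "mset xs = M" and len: "length xs = n"
        using xs length_finite_permutations_of_multiset[OF xs]
        by (simp_all add: permutations_of_multiset_def size_M)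
      have "set xs \<subseteq> {1..s}"
        using count_M by (auto simp: M[symmetric] simp flip: count_greater_zero_iff set_mset_mset split: if_splits)
      then have "xs ! (i - 1) \<in> {1..s}" if "i \<in> {1..n}" for i
      proof -
        have "xs ! (i - 1) \<in> set xs" by (rule nth_mem) (use that len in auto)
        with \<open>set xs \<subseteq> {1..s}\<close> show ?thesis by blast
      qed
      then show "?f \<in> {1..n} \<rightarrow>\<^sub>E {1..s}" by (intro restrict_PiE_iff[THEN iffD2] ballI)
      have count: "count M p = card {i \<in> {1..n}. ?f i = p}" for p
        using count_map[of ?f p] by (simp only: map_nth[OF xs] M)
      have "fibre_sizes s n ?f p = a p" for p
      proof (cases "p \<in> {1..s}")
        case True
        then have "a p = count M p" by (simp add: count_M)
        then show ?thesis
          unfolding count using True by (simp only: fibre_sizes_def restrict_apply' refl)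
      next
        case False
        then show ?thesis
          using a by (auto simp: fibre_sizes_def compositions_def PiE_def extensional_def)
      qed
      then show "fibre_sizes s n ?f = a" by (rule ext)
    qed
    show "\<forall>f\<in>{f \<in> {1..n} \<rightarrow>\<^sub>E {1..s}. fibre_sizes s n f = a}.
        (\<lambda>i\<in>{1..n}. map f [1..<Suc n] ! (i - 1)) = f"
      by (auto simp: PiE_def extensional_def fun_eq_iff simp del: upt_Suc)
  qed
  then have "card {f \<in> {1..n} \<rightarrow>\<^sub>E {1..s}. fibre_sizes s n f = a} = card (permutations_of_multiset M)"
    by (rule bij_betw_same_card)
  ultimately show ?thesis by (rule trans[rotated])
qed

text \<open>Labelings are grouped by their fibre sizes; the group of \<open>a\<close> has
  multinomial size and \<open>\<phi>\<close> is constant on it.\<close>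

lemma sum_fibre_sizes:
  "(\<Sum>f \<in> {1..n} \<rightarrow>\<^sub>E {1..s}. \<phi> (fibre_sizes s n f))
    = (\<Sum>a \<in> compositions s n. multinomial s n a * (\<phi> a :: nat))"
proof -
  have "(\<Sum>f \<in> {1..n} \<rightarrow>\<^sub>E {1..s}. \<phi> (fibre_sizes s n f))
      = (\<Sum>a \<in> compositions s n. \<Sum>f | f \<in> {1..n} \<rightarrow>\<^sub>E {1..s} \<and> fibre_sizes s n f = a. \<phi> (fibre_sizes s n f))"
    by (rule sum.group[symmetric])
       (auto simp: finite_PiE finite_compositions fibre_sizes_in_compositions simp del: PiE_iff)
  also have "\<dots> = (\<Sum>a \<in> compositions s n. multinomial s n a * \<phi> a)"
    by (intro sum.cong refl) (simp add: card_fibre_sizes[symmetric])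
  finally show ?thesis .
qed

text \<open>Swapping coordinates matches the pairs above the diagonal with those below it.\<close>

lemma sum_offdiagonal_symmetric:
  fixes w :: "nat \<Rightarrow> nat \<Rightarrow> nat"
  assumes fin: "finite S" and sym: "\<And>i j. w i j = w j i"
  shows "(\<Sum>(i, j) | i \<in> S \<and> j \<in> S \<and> i \<noteq> j. w i j) = 2 * (\<Sum>(i, j) | i \<in> S \<and> j \<in> S \<and> i < j. w i j)"
proof -
  have finS: "finite {(i, j). i \<in> S \<and> j \<in> S \<and> P i j}" for P
    by (rule finite_subset[of _ "S \<times> S"]) (auto simp: fin)
  have "{(i, j). i \<in> S \<and> j \<in> S \<and> i \<noteq> j} =
      {(i, j). i \<in> S \<and> j \<in> S \<and> i < j} \<union> {(i, j). i \<in> S \<and> j \<in> S \<and> j < i}"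
    by auto
  then have "(\<Sum>(i, j) | i \<in> S \<and> j \<in> S \<and> i \<noteq> j. w i j) =
      (\<Sum>(i, j) | i \<in> S \<and> j \<in> S \<and> i < j. w i j) + (\<Sum>(i, j) | i \<in> S \<and> j \<in> S \<and> j < i. w i j)"
    by (simp only:) (rule sum.union_disjoint[OF finS finS], auto)
  moreover have "(\<Sum>(i, j) | i \<in> S \<and> j \<in> S \<and> j < i. w i j) = (\<Sum>(i, j) | i \<in> S \<and> j \<in> S \<and> i < j. w i j)"
    by (rule sum.reindex_bij_witness[of _ prod.swap prod.swap]) (auto simp: sym)
  ultimately show ?thesis by simp
qed

text \<open>Pairs \<open>(i, j)\<close> are grouped by their labels \<open>(p, p')\<close>; each
  group is the product of a fibre of \<open>f\<close> and a fibre of \<open>g\<close>.\<close>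

lemma card_distinct_labels:
  assumes f: "f \<in> {1..n} \<rightarrow>\<^sub>E {1..s}" and g: "g \<in> {1..m} \<rightarrow>\<^sub>E {1..s}"
  shows "card {(i, j). i \<in> {1..n} \<and> j \<in> {1..m} \<and> f i \<noteq> g j}
    = (\<Sum>(p, p') | p \<in> {1..s} \<and> p' \<in> {1..s} \<and> p \<noteq> p'. fibre_sizes s n f p * fibre_sizes s m g p')"
proof -
  let ?P = "{(i, j). i \<in> {1..n} \<and> j \<in> {1..m} \<and> f i \<noteq> g j}"
  let ?Q = "{(p, p'). p \<in> {1..s} \<and> p' \<in> {1..s} \<and> p \<noteq> p'}"
  have finP: "finite ?P" by (rule finite_subset[of _ "{1..n} \<times> {1..m}"]) auto
  have finQ: "finite ?Q" by (rule finite_subset[of _ "{1..s} \<times> {1..s}"]) auto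
  have "card ?P = (\<Sum>z\<in>?Q. card {x \<in> ?P. map_prod f g x = z})"
    using sum.group[OF finP finQ, of "map_prod f g" "\<lambda>_. 1::nat"] f g by (fastforce simp: PiE_def)
  also have "\<dots> = (\<Sum>(p, p')\<in>?Q. fibre_sizes s n f p * fibre_sizes s m g p')"
  proof (intro sum.cong refl, clarify)
    fix p p' assume pp: "p \<in> {1..s}" "p' \<in> {1..s}" "p \<noteq> p'"
    have "{x \<in> ?P. map_prod f g x = (p, p')} = {i \<in> {1..n}. f i = p} \<times> {j \<in> {1..m}. g j = p'}"
      using pp by auto
    then show "card {x \<in> ?P. map_prod f g x = (p, p')} = fibre_sizes s n f p * fibre_sizes s m g p'"
      using pp by (simp add: fibre_sizes_def card_cartesian_product)
  qed
  finally show ?thesis .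
qed

text \<open>The order of the positions has no relation to the order of their labels, so pairs are
  not matched directly. Instead both sides are half of a symmetric count over unordered positions or
  labels, where \<open>card_distinct_labels\<close> applies.\<close>

lemma card_distinct_labels_less:
  assumes f: "f \<in> {1..n} \<rightarrow>\<^sub>E {1..s}"
  shows "card {(i, j). i \<in> {1..n} \<and> j \<in> {1..n} \<and> i < j \<and> f i \<noteq> f j}
    = (\<Sum>(p, p') | 1 \<le> p \<and> p < p' \<and> p' \<le> s. fibre_sizes s n f p * fibre_sizes s n f p')"
proof -
  \<comment> \<open>Cardinalities become sums of 0/1 weights, to which
    \<open>sum_offdiagonal_symmetric\<close> applies.\<close>
  have indicator: "(\<Sum>(i, j) | i \<in> {1..n} \<and> j \<in> {1..n} \<and> R i j. of_bool (f i \<noteq> f j))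
      = card {(i, j). i \<in> {1..n} \<and> j \<in> {1..n} \<and> R i j \<and> f i \<noteq> f j}" for R
  proof -
    have "finite {(i, j). i \<in> {1..n} \<and> j \<in> {1..n} \<and> R i j}"
      by (rule finite_subset[of _ "{1..n} \<times> {1..n}"]) auto
    then have "(\<Sum>(i, j) | i \<in> {1..n} \<and> j \<in> {1..n} \<and> R i j. of_bool (f i \<noteq> f j))
      = (\<Sum>(i, j) | i \<in> {1..n} \<and> j \<in> {1..n} \<and> R i j \<and> f i \<noteq> f j. 1::nat)"
      by (intro sum.mono_neutral_cong_right) auto
    then show ?thesis by (simp add: case_prod_unfold)
  qed
  have "2 * card {(i, j). i \<in> {1..n} \<and> j \<in> {1..n} \<and> i < j \<and> f i \<noteq> f j}
      = card {(i, j). i \<in> {1..n} \<and> j \<in> {1..n} \<and> i \<noteq> j \<and> f i \<noteq> f j}"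
    unfolding indicator[symmetric]
    by (rule sum_offdiagonal_symmetric[symmetric]) (auto simp: of_bool_def)
  also have "{(i, j). i \<in> {1..n} \<and> j \<in> {1..n} \<and> i \<noteq> j \<and> f i \<noteq> f j}
      = {(i, j). i \<in> {1..n} \<and> j \<in> {1..n} \<and> f i \<noteq> f j}"
    by auto
  also have "card \<dots> = 2 * (\<Sum>(p, p') | p \<in> {1..s} \<and> p' \<in> {1..s} \<and> p < p'.
      fibre_sizes s n f p * fibre_sizes s n f p')"
    unfolding card_distinct_labels[OF f f]
    by (rule sum_offdiagonal_symmetric) (simp_all add: mult.commute)
  also have "{(p, p'). p \<in> {1..s} \<and> p' \<in> {1..s} \<and> p < p'} = {(p, p'). 1 \<le> p \<and> p < p' \<and> p' \<le> s}"
    by auto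
  finally show ?thesis by simp
qed

section \<open>The poset \<open>Y\<close>\<close>

text \<open>A closed form of the generated order, without the bounds on the indices.\<close>

fun Y_ord :: "Y_elem \<Rightarrow> Y_elem \<Rightarrow> bool" where
  "Y_ord (Yr i) (Yr j) \<longleftrightarrow> i \<le> j"
| "Y_ord (Ys i) (Ys j) \<longleftrightarrow> i \<le> j"
| "Y_ord (Yt i) (Yt j) \<longleftrightarrow> i \<le> j"
| "Y_ord (Yr i) _ \<longleftrightarrow> True"
| "Y_ord _ _ \<longleftrightarrow> False"

lemma Y_ord_refl: "Y_ord x x"
  by (cases x) auto

lemma Y_ord_trans: "Y_ord x y \<Longrightarrow> Y_ord y z \<Longrightarrow> Y_ord x z"
  by (cases x; cases y; cases z) auto

lemma Y_ord_antisym: "Y_ord x y \<Longrightarrow> Y_ord y x \<Longrightarrow> x = y"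
  by (cases x; cases y) auto

lemma Y_carrier_iff:
  "Yr i \<in> Y_carrier n m l \<longleftrightarrow> i \<in> {1..n}"
  "Ys i \<in> Y_carrier n m l \<longleftrightarrow> i \<in> {1..m}"
  "Yt i \<in> Y_carrier n m l \<longleftrightarrow> i \<in> {1..l}"
  by (auto simp: Y_carrier_def)

text \<open>Every generator satisfies the reflexive and transitive \<open>Y_ord\<close>. Conversely,
  comparable elements are joined by a path along one chain, or through \<open>Yr n\<close> into
  another.\<close>

lemma Y_le_eq: "Y_le n m l = {(x, y). x \<in> Y_carrier n m l \<and> y \<in> Y_carrier n m l \<and> Y_ord x y}"
proof -
  have "Y_ord x y" if "(x, y) \<in> (Y_gen n m l)\<^sup>*" for x y
    using that
  proof (induction rule: rtrancl_induct)
    case (step y z)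
    from step.hyps(2) have "Y_ord y z" by (auto simp: Y_gen_def)
    with step.IH show ?case by (rule Y_ord_trans)
  qed (rule Y_ord_refl)
  moreover have "(x, y) \<in> (Y_gen n m l)\<^sup>*"
    if "x \<in> Y_carrier n m l" "y \<in> Y_carrier n m l" "Y_ord x y" for x y
  proof -
    \<comment> \<open>Here \<open>c\<close> will be \<open>Yr\<close>, \<open>Ys\<close> or
      \<open>Yt\<close>.\<close>
    have chain: "(c i, c j) \<in> (Y_gen n m l)\<^sup>*"
      if "i \<le> j" "\<And>k. i \<le> k \<Longrightarrow> k < j \<Longrightarrow> (c k, c (Suc k)) \<in> Y_gen n m l" for c :: "nat \<Rightarrow> Y_elem" and i j
      using that
    proof (induction j rule: dec_induct)
      case (step j)
      have "(c i, c j) \<in> (Y_gen n m l)\<^sup>*" by (rule step.IH) (use step.prems in auto)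
      moreover have "(c j, c (Suc j)) \<in> Y_gen n m l" by (rule step.prems) (use step.hyps in auto)
      ultimately show ?case by (rule rtrancl_into_rtrancl)
    qed simp
    have r: "(Yr i, Yr j) \<in> (Y_gen n m l)\<^sup>*" if "1 \<le> i" "i \<le> j" "j \<le> n" for i j
      using that by (intro chain) (auto simp: Y_gen_def)
    have s: "(Ys i, Ys j) \<in> (Y_gen n m l)\<^sup>*" if "1 \<le> i" "i \<le> j" "j \<le> m" for i j
      using that by (intro chain) (auto simp: Y_gen_def)
    have t: "(Yt i, Yt j) \<in> (Y_gen n m l)\<^sup>*" if "1 \<le> i" "i \<le> j" "j \<le> l" for i j
      using that by (intro chain) (auto simp: Y_gen_def)
    \<comment> \<open>The path climbs to \<open>Yr n\<close> and then takes a single generator, as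
      \<open>Yr n\<close> is directly below each \<open>Ys j\<close>.\<close>
    have rs: "(Yr i, Ys j) \<in> (Y_gen n m l)\<^sup>*" if "1 \<le> i" "i \<le> n" "1 \<le> j" "j \<le> m" for i j
      by (rule rtrancl_into_rtrancl[OF r[of i n]]) (use that in \<open>auto simp: Y_gen_def\<close>)
    have rt: "(Yr i, Yt j) \<in> (Y_gen n m l)\<^sup>*" if "1 \<le> i" "i \<le> n" "1 \<le> j" "j \<le> l" for i j
      by (rule rtrancl_into_rtrancl[OF r[of i n]]) (use that in \<open>auto simp: Y_gen_def\<close>)
    show ?thesis
      using that by (cases x; cases y) (auto simp: Y_carrier_iff intro: r s t rs rt)
  qed
  ultimately show ?thesis by (auto simp: Y_le_def)
qed

lemma finite_Y_carrier: "finite (Y_carrier n m l)"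
  by (simp add: Y_carrier_def)

lemma partial_order_Y_le: "partial_order_on (Y_carrier n m l) (Y_le n m l)"
proof -
  have "refl_on (Y_carrier n m l) (Y_le n m l)"
    by (auto simp: Y_le_eq refl_on_def Y_ord_refl)
  moreover have "trans (Y_le n m l)"
    unfolding Y_le_eq using Y_ord_trans by (blast intro: transI)
  moreover have "antisym (Y_le n m l)"
    unfolding Y_le_eq using Y_ord_antisym by (blast intro: antisymI)
  ultimately show ?thesis
    by (auto simp: partial_order_on_def preorder_on_def Y_le_def)
qed

text \<open>Comparable pairs lie within one of the three chains or lead from the first chain to one
  of the others. Within a chain only \<open>i < j\<close> can give distinct labels.\<close>

lemma card_Y_distinct_labels:
  "card {(x, y) \<in> Y_le n m l. d x \<noteq> d y} =
    card {(i, j). i \<in> {1..n} \<and> j \<in> {1..n} \<and> i < j \<and> d (Yr i) \<noteq> d (Yr j)} +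
    card {(i, j). i \<in> {1..m} \<and> j \<in> {1..m} \<and> i < j \<and> d (Ys i) \<noteq> d (Ys j)} +
    card {(i, j). i \<in> {1..l} \<and> j \<in> {1..l} \<and> i < j \<and> d (Yt i) \<noteq> d (Yt j)} +
    card {(i, j). i \<in> {1..n} \<and> j \<in> {1..m} \<and> d (Yr i) \<noteq> d (Ys j)} +
    card {(i, j). i \<in> {1..n} \<and> j \<in> {1..l} \<and> d (Yr i) \<noteq> d (Yt j)}"
    (is "_ = card ?A1 + card ?A2 + card ?A3 + card ?A4 + card ?A5")
proof -
  have fin: "finite ?A1" "finite ?A2" "finite ?A3" "finite ?A4" "finite ?A5"
    by (rule finite_subset[of _ "{1..n+m+l} \<times> {1..n+m+l}"]; auto)+
  have map_prod_image_iff: "(x, y) \<in> map_prod c c' ` B \<longleftrightarrow> (\<exists>i j. x = c i \<and> y = c' j \<and> (i, j) \<in> B)"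
    for x y and c c' :: "nat \<Rightarrow> Y_elem" and B
    by force
  have card_union: "card (map_prod Yr Yr ` B1 \<union> map_prod Ys Ys ` B2 \<union> map_prod Yt Yt ` B3 \<union>
      map_prod Yr Ys ` B4 \<union> map_prod Yr Yt ` B5) = card B1 + card B2 + card B3 + card B4 + card B5"
    if "finite B1" "finite B2" "finite B3" "finite B4" "finite B5" for B1 B2 B3 B4 B5
  proof -
    have inj: "inj_on (map_prod c c') B" if "inj c" "inj c'" for c c' :: "nat \<Rightarrow> Y_elem" and B
      using that by (auto simp: inj_on_def)
    have injs: "inj Yr" "inj Ys" "inj Yt"
      by (auto simp: inj_def)
    have "map_prod Yr Yr ` B1 \<inter> map_prod Ys Ys ` B2 = {}"
      "(map_prod Yr Yr ` B1 \<union> map_prod Ys Ys ` B2) \<inter> map_prod Yt Yt ` B3 = {}"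
      "(map_prod Yr Yr ` B1 \<union> map_prod Ys Ys ` B2 \<union> map_prod Yt Yt ` B3) \<inter> map_prod Yr Ys ` B4 = {}"
      "(map_prod Yr Yr ` B1 \<union> map_prod Ys Ys ` B2 \<union> map_prod Yt Yt ` B3 \<union> map_prod Yr Ys ` B4) \<inter>
        map_prod Yr Yt ` B5 = {}"
      by auto
    then show ?thesis
      using that by (simp only: card_Un_disjoint card_image[OF inj] injs finite_imageI finite_UnI)
  qed
  have "{(x, y) \<in> Y_le n m l. d x \<noteq> d y} = map_prod Yr Yr ` ?A1 \<union> map_prod Ys Ys ` ?A2 \<union>
      map_prod Yt Yt ` ?A3 \<union> map_prod Yr Ys ` ?A4 \<union> map_prod Yr Yt ` ?A5"
    (is "?L = ?R")
  proof (rule Set.set_eqI)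
    fix z :: "Y_elem \<times> Y_elem"
    obtain x y where z: "z = (x, y)" by (cases z)
    show "z \<in> ?L \<longleftrightarrow> z \<in> ?R"
      unfolding z Un_iff map_prod_image_iff
      by (cases x; cases y) (auto simp: Y_le_eq Y_carrier_iff le_less)
  qed
  then show ?thesis
    by (simp only: card_union[OF fin])
qed

text \<open>A labeling of \<open>Y\<close> is a triple of labelings of its chains. The exponent
  depends only on which labels coincide, so the elements of \<open>R\<close> may be renamed 1 to
  \<open>s\<close>.\<close>

lemma sum_power_distinct_labels:
  fixes R :: "'c set" and q :: nat
  assumes R: "finite R" "card R = s"
  shows "(\<Sum>d \<in> Y_carrier n m l \<rightarrow>\<^sub>E R. q ^ card {(x, y) \<in> Y_le n m l. d x \<noteq> d y}) =
    (\<Sum>f \<in> {1..n} \<rightarrow>\<^sub>E {1..s}. \<Sum>g \<in> {1..m} \<rightarrow>\<^sub>E {1..s}. \<Sum>h \<in> {1..l} \<rightarrow>\<^sub>E {1..s}.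
      F_count q s (fibre_sizes s n f) (fibre_sizes s m g) (fibre_sizes s l h))"
proof -
  obtain e where e: "bij_betw e {1..s} R"
    using ex_bij_betw_nat_finite_1[OF R(1)] R(2) by blast
  define e' where "e' = inv_into {1..s} e"
  have e'e: "e' (e p) = p" if "p \<in> {1..s}" for p
    using e that by (simp add: e'_def bij_betw_inv_into_left)
  have ee': "e (e' x) = x" if "x \<in> R" for x
    using e that by (simp add: e'_def bij_betw_inv_into_right)
  have e_in: "e p \<in> R" if "p \<in> {1..s}" for p
    using e that by (rule bij_betw_apply)
  have e'_in: "e' x \<in> {1..s}" if "x \<in> R" for x
    using bij_betw_inv_into[OF e] that unfolding e'_def by (rule bij_betw_apply)
  define \<Phi> where "\<Phi> = (\<lambda>d. (\<lambda>i\<in>{1..n}. e' (d (Yr i)), \<lambda>i\<in>{1..m}. e' (d (Ys i)), \<lambda>i\<in>{1..l}. e' (d (Yt i))))"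
  define \<Psi> where "\<Psi> = (\<lambda>(f, g, h). \<lambda>x\<in>Y_carrier n m l. e (case x of Yr i \<Rightarrow> f i | Ys i \<Rightarrow> g i | Yt i \<Rightarrow> h i))"
  have "(\<Sum>d \<in> Y_carrier n m l \<rightarrow>\<^sub>E R. q ^ card {(x, y) \<in> Y_le n m l. d x \<noteq> d y}) =
    (\<Sum>(f, g, h) \<in> ({1..n} \<rightarrow>\<^sub>E {1..s}) \<times> ({1..m} \<rightarrow>\<^sub>E {1..s}) \<times> ({1..l} \<rightarrow>\<^sub>E {1..s}).
      F_count q s (fibre_sizes s n f) (fibre_sizes s m g) (fibre_sizes s l h))"
  proof (rule sum.reindex_bij_witness[of _ \<Psi> \<Phi>])
    fix d assume d: "d \<in> Y_carrier n m l \<rightarrow>\<^sub>E R"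
    obtain f g h where fgh: "\<Phi> d = (f, g, h)" by (cases "\<Phi> d")
    have d_in: "d x \<in> R" if "x \<in> Y_carrier n m l" for x
      using d that by (rule PiE_mem)
    have "\<Psi> (\<Phi> d) x = d x" for x
    proof (cases "x \<in> Y_carrier n m l")
      case True
      then show ?thesis
        using ee'[OF d_in[OF True]]
        by (cases x) (simp_all add: \<Phi>_def \<Psi>_def Y_carrier_iff)
    next
      case False
      then show ?thesis by (simp add: \<Phi>_def \<Psi>_def PiE_arb[OF d])
    qed
    then show "\<Psi> (\<Phi> d) = d" by (rule ext)
    show "\<Phi> d \<in> ({1..n} \<rightarrow>\<^sub>E {1..s}) \<times> ({1..m} \<rightarrow>\<^sub>E {1..s}) \<times> ({1..l} \<rightarrow>\<^sub>E {1..s})"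
      unfolding \<Phi>_def by (intro SigmaI restrict_PiE_iff[THEN iffD2] ballI e'_in d_in) (simp_all add: Y_carrier_iff)
    then have f: "f \<in> {1..n} \<rightarrow>\<^sub>E {1..s}" and g: "g \<in> {1..m} \<rightarrow>\<^sub>E {1..s}" and h: "h \<in> {1..l} \<rightarrow>\<^sub>E {1..s}"
      by (simp_all add: fgh)
    have f_eq: "f i = e' (d (Yr i))" if "i \<in> {1..n}" for i using fgh that by (auto simp: \<Phi>_def)
    have g_eq: "g i = e' (d (Ys i))" if "i \<in> {1..m}" for i using fgh that by (auto simp: \<Phi>_def)
    have h_eq: "h i = e' (d (Yt i))" if "i \<in> {1..l}" for i using fgh that by (auto simp: \<Phi>_def)
    have e'_eq: "d x \<noteq> d y \<longleftrightarrow> e' (d x) \<noteq> e' (d y)"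
      if "x \<in> Y_carrier n m l" "y \<in> Y_carrier n m l" for x y
      using ee'[OF d_in[OF that(1)]] ee'[OF d_in[OF that(2)]] by metis
    have "card {(x, y) \<in> Y_le n m l. d x \<noteq> d y} =
        card {(i, j). i \<in> {1..n} \<and> j \<in> {1..n} \<and> i < j \<and> f i \<noteq> f j} +
        card {(i, j). i \<in> {1..m} \<and> j \<in> {1..m} \<and> i < j \<and> g i \<noteq> g j} +
        card {(i, j). i \<in> {1..l} \<and> j \<in> {1..l} \<and> i < j \<and> h i \<noteq> h j} +
        card {(i, j). i \<in> {1..n} \<and> j \<in> {1..m} \<and> f i \<noteq> g j} +
        card {(i, j). i \<in> {1..n} \<and> j \<in> {1..l} \<and> f i \<noteq> h j}"
      unfolding card_Y_distinct_labels
      by (intro arg_cong2[where f = "(+)"] arg_cong[where f = card] Collect_cong)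
         (auto simp: f_eq g_eq h_eq e'_eq Y_carrier_iff)
    \<comment> \<open>The three chains give the first exponent of \<open>F_count\<close>; the pairs
      from the first chain to the other two merge into the second.\<close>
    then have card_eq: "card {(x, y) \<in> Y_le n m l. d x \<noteq> d y} =
        (\<Sum>(p, p') | 1 \<le> p \<and> p < p' \<and> p' \<le> s. fibre_sizes s n f p * fibre_sizes s n f p' +
          fibre_sizes s m g p * fibre_sizes s m g p' + fibre_sizes s l h p * fibre_sizes s l h p') +
        (\<Sum>(p, p') | p \<in> {1..s} \<and> p' \<in> {1..s} \<and> p \<noteq> p'.
          fibre_sizes s n f p * (fibre_sizes s m g p' + fibre_sizes s l h p'))"
      unfolding card_distinct_labels[OF f g] card_distinct_labels[OF f h] card_distinct_labels_less[OF f]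
        card_distinct_labels_less[OF g] card_distinct_labels_less[OF h]
      by (simp only: case_prod_unfold sum.distrib distrib_left add.assoc)
    show "(case \<Phi> d of (f, g, h) \<Rightarrow> F_count q s (fibre_sizes s n f) (fibre_sizes s m g) (fibre_sizes s l h)) =
        q ^ card {(x, y) \<in> Y_le n m l. d x \<noteq> d y}"
      unfolding fgh card_eq by (simp only: F_count_def power_add prod.case)
  next
    fix t assume t: "t \<in> ({1..n} \<rightarrow>\<^sub>E {1..s}) \<times> ({1..m} \<rightarrow>\<^sub>E {1..s}) \<times> ({1..l} \<rightarrow>\<^sub>E {1..s})"
    obtain f g h where fgh: "t = (f, g, h)" by (cases t)
    have mem: "f \<in> {1..n} \<rightarrow>\<^sub>E {1..s}" "g \<in> {1..m} \<rightarrow>\<^sub>E {1..s}" "h \<in> {1..l} \<rightarrow>\<^sub>E {1..s}"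
      using t by (simp_all add: fgh)
    show "\<Psi> t \<in> Y_carrier n m l \<rightarrow>\<^sub>E R"
      unfolding \<Psi>_def fgh prod.case
    proof (intro restrict_PiE_iff[THEN iffD2] ballI e_in)
      fix x assume "x \<in> Y_carrier n m l"
      then show "(case x of Yr i \<Rightarrow> f i | Ys i \<Rightarrow> g i | Yt i \<Rightarrow> h i) \<in> {1..s}"
        using PiE_mem[OF mem(1)] PiE_mem[OF mem(2)] PiE_mem[OF mem(3)]
        by (cases x) (simp_all add: Y_carrier_iff del: atLeastAtMost_iff)
    qed
    have restrict_id: "(\<lambda>i\<in>I. e' (e (u i))) = u" if u: "u \<in> I \<rightarrow>\<^sub>E {1..s}" for u :: "nat \<Rightarrow> nat" and I
    proof
      show "(\<lambda>i\<in>I. e' (e (u i))) i = u i" for i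
        using e'e[OF PiE_mem[OF u]] PiE_arb[OF u] by (cases "i \<in> I") simp_all
    qed
    have "(\<lambda>i\<in>{1..n}. e' (e (f i))) = f" "(\<lambda>i\<in>{1..m}. e' (e (g i))) = g" "(\<lambda>i\<in>{1..l}. e' (e (h i))) = h"
      by (rule restrict_id, fact)+
    then show "\<Phi> (\<Psi> t) = t"
      by (simp add: \<Phi>_def \<Psi>_def fgh Y_carrier_iff cong: restrict_cong)
  qed
  then show ?thesis by (simp add: sum.cartesian_product)
qed

theorem theorem1p5:
  fixes k n m l s q :: nat
  assumes "k \<ge> 1"
    and "CARD('a) = q"
    and "\<not> CHAR('a) dvd k"
    and "\<not> CHAR('a) dvd k + 1"
    and "n \<ge> 1" and "m \<ge> 1" and "l \<ge> 1"
    and "card {x::'a::{field,finite}. x ^ (k + 1) = x} = s"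
  shows "card (potents (incidence_algebra (Y_carrier n m l) (Y_le n m l)
                 :: ('a, Y_elem \<times> Y_elem \<Rightarrow> 'a) module) (k + 1)) =
    (\<Sum>a \<in> compositions s n. \<Sum>b \<in> compositions s m. \<Sum>c \<in> compositions s l.
       multinomial s n a * multinomial s m b * multinomial s l c * F_count q s a b c)"
proof -
  interpret finite_incidence_algebra "Y_carrier n m l" "Y_le n m l"
    "incidence_algebra (Y_carrier n m l) (Y_le n m l) :: ('a, Y_elem \<times> Y_elem \<Rightarrow> 'a) module"
    by unfold_locales (simp_all add: finite_Y_carrier partial_order_Y_le)
  \<comment> \<open>The characteristic not dividing \<open>k\<close> makes the averaging over
    \<open>k\<close> powers possible.\<close>
  have "(of_nat k :: 'a) \<noteq> 0"
    using assms(3) by (simp add: of_nat_eq_0_iff_char_dvd)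
  then have "card (potents (incidence_algebra (Y_carrier n m l) (Y_le n m l)
                 :: ('a, Y_elem \<times> Y_elem \<Rightarrow> 'a) module) (k + 1)) =
      (\<Sum>d \<in> Y_carrier n m l \<rightarrow>\<^sub>E {x::'a. x ^ (k + 1) = x}. q ^ card {(x, y) \<in> Y_le n m l. d x \<noteq> d y})"
    using card_potents[OF assms(1)] unfolding assms(2) by blast
  also have "\<dots> = (\<Sum>f \<in> {1..n} \<rightarrow>\<^sub>E {1..s}. \<Sum>g \<in> {1..m} \<rightarrow>\<^sub>E {1..s}. \<Sum>h \<in> {1..l} \<rightarrow>\<^sub>E {1..s}.
      F_count q s (fibre_sizes s n f) (fibre_sizes s m g) (fibre_sizes s l h))"
    by (rule sum_power_distinct_labels) (use assms(8) in auto)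
  \<comment> \<open>The sums over labelings are replaced from the innermost outwards, each producing
    one multinomial factor.\<close>
  also have "\<dots> = (\<Sum>a \<in> compositions s n. \<Sum>b \<in> compositions s m. \<Sum>c \<in> compositions s l.
       multinomial s n a * multinomial s m b * multinomial s l c * F_count q s a b c)"
    by (simp only: sum_fibre_sizes[where \<phi> = "\<lambda>c. F_count q s _ _ c"]
        sum_fibre_sizes[where \<phi> = "\<lambda>b. \<Sum>c \<in> compositions s l. multinomial s l c * F_count q s _ b c"]
        sum_fibre_sizes[where \<phi> = "\<lambda>a. \<Sum>b \<in> compositions s m. multinomial s m b *
          (\<Sum>c \<in> compositions s l. multinomial s l c * F_count q s a b c)"])
       (simp only: sum_distrib_left mult.assoc)
  finally show ?thesis .
qed

end
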